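(* Let $f:X\to X$ be a function on a set $X$. Let $X=\coprod_{s\in S}X_s$ be the partition of $X$ into the vertex sets of the connected components of $\Gamma_f$, and let $S=\coprod_{i}C_i$ be the coarsest partition of $S$ such that for each $i$ all the digraphs $\Gamma_{f|_{X_s}}$, $s\in C_i$, are mutually isomorphic. For each $i$ let $f_i$ denote any one of the restrictions $f|_{X_s}:X_s\to X_s$, $s\in C_i$. Then there is a decomposition $$\mathrm{Aut}(f)\cong\prod_i\bigl(\mathrm{Aut}(f_i)\wr\Sigma_{C_i}\bigr).$$
   Context: All sets are non-empty. $\Sigma_X$ is the group of all permutations of $X$. For $f:X\to X$, $\mathrm{Aut}(f)=\{\sigma\in\Sigma_X:\sigma\circ f=f\circ\sigma\}$. The functional digraph $\Gamma_f$ has vertex set $X$ and an edge $x\to y$ precisely when $y=f(x)$ and $x\ne y$; its connected components are those of the underlying undirected graph (each is $f$-invariant). For a group $G$ and a set $C$, $G\wr\Sigma_C$ is the (unrestricted) wreath product $G^C\rtimes\Sigma_C$ with $\Sigma_C$ permuting the coordinates. *)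

theory Defs
  imports
    "HOL-Algebra.Bij"
    "HOL-Algebra.Product_Groups"
    "HOL-Library.Disjoint_Sets"
    "Graph_Theory.Digraph_Isomorphism"
begin

definition functional_digraph :: "'a set \<Rightarrow> ('a \<Rightarrow> 'a) \<Rightarrow> ('a, 'a \<times> 'a) pre_digraph" where
  "functional_digraph X f =
     with_proj \<lparr>pverts = X, parcs = {(x, y). x \<in> X \<and> y = f x \<and> x \<noteq> y}\<rparr>"

text \<open>The connected components of the underlying undirected graph are the strong components of
  the symmetrization.\<close>

definition component_vertex_sets :: "('a, 'b) pre_digraph \<Rightarrow> 'a set set" where
  "component_vertex_sets G = verts ` pre_digraph.sccs (with_proj (mk_symmetric G))"

definition coarsest_partition_on :: "'s set \<Rightarrow> ('s set set \<Rightarrow> bool) \<Rightarrow> 's set set \<Rightarrow> bool" where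
  "coarsest_partition_on S \<Phi> P \<longleftrightarrow>
     partition_on S P \<and> \<Phi> P \<and> (\<forall>Q. partition_on S Q \<and> \<Phi> Q \<longrightarrow> refines S Q P)"

text \<open>As in \<^const>\<open>BijGroup\<close>, permutations of \<open>X\<close> are functions extensional on \<open>X\<close>; only the values
  of \<open>f\<close> on \<open>X\<close> matter.\<close>

definition Aut :: "'a set \<Rightarrow> ('a \<Rightarrow> 'a) \<Rightarrow> ('a \<Rightarrow> 'a) monoid" where
  "Aut X f = (BijGroup X)\<lparr>carrier := {\<sigma> \<in> Bij X. compose X \<sigma> f = compose X f \<sigma>}\<rparr>"

definition semidirect_product ::
    "('n, 'c) monoid_scheme \<Rightarrow> ('h, 'd) monoid_scheme \<Rightarrow> ('h \<Rightarrow> 'n \<Rightarrow> 'n) \<Rightarrow> ('n \<times> 'h) monoid" where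
  "semidirect_product N H \<phi> =
     \<lparr>carrier = carrier N \<times> carrier H,
      monoid.mult = (\<lambda>(n, h) (n', h'). (n \<otimes>\<^bsub>N\<^esub> \<phi> h n', h \<otimes>\<^bsub>H\<^esub> h')),
      one = (\<one>\<^bsub>N\<^esub>, \<one>\<^bsub>H\<^esub>)\<rparr>"

text \<open>The inverse makes the coordinate permutation a left action.\<close>

definition permute_coords :: "'s set \<Rightarrow> ('s \<Rightarrow> 's) \<Rightarrow> ('s \<Rightarrow> 'g) \<Rightarrow> 's \<Rightarrow> 'g" where
  "permute_coords C \<sigma> a = (\<lambda>c\<in>C. a (inv_into C \<sigma> c))"

definition wreath_product ::
    "('g, 'c) monoid_scheme \<Rightarrow> 's set \<Rightarrow> (('s \<Rightarrow> 'g) \<times> ('s \<Rightarrow> 's)) monoid" where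
  "wreath_product G C =
     semidirect_product (product_group C (\<lambda>_. G)) (BijGroup C) (permute_coords C)"

lemma group_Aut:
  assumes f: "f \<in> X \<rightarrow> X"
  shows "group (Aut X f)"
proof -
  interpret group "BijGroup X" by (rule group_BijGroup)
  let ?H = "{\<sigma> \<in> Bij X. compose X \<sigma> f = compose X f \<sigma>}"
  have comm: "compose X \<sigma> f = compose X f \<sigma> \<longleftrightarrow> (\<forall>x\<in>X. \<sigma> (f x) = f (\<sigma> x))" for \<sigma>
    by (auto simp: compose_def restrict_def fun_eq_iff)
  have "subgroup ?H (BijGroup X)"
  proof (rule subgroupI)
    show "?H \<subseteq> carrier (BijGroup X)" by (auto simp: BijGroup_def)
    have "(\<lambda>x\<in>X. x) \<in> ?H" using f by (auto simp: comm id_Bij Pi_iff)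
    then show "?H \<noteq> {}" by blast
  next
    fix \<sigma> assume s: "\<sigma> \<in> ?H"
    then have B: "\<sigma> \<in> Bij X" and bb: "bij_betw \<sigma> X X" by (auto simp: Bij_def)
    have "inv\<^bsub>BijGroup X\<^esub> \<sigma> = (\<lambda>x\<in>X. inv_into X \<sigma> x)"
      using B by (intro inv_equality)
        (auto simp: BijGroup_def restrict_inv_into_Bij Bij_compose_restrict_eq)
    moreover have "inv_into X \<sigma> (f x) = f (inv_into X \<sigma> x)" if x: "x \<in> X" for x
    proof -
      let ?y = "inv_into X \<sigma> x"
      have y: "?y \<in> X" "\<sigma> ?y = x"
        using x bb by (auto simp: Bij_inv_into_mem[OF B] bij_betw_inv_into_right)
      then have "\<sigma> (f ?y) = f x" using s by (auto simp: comm)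
      moreover have "f ?y \<in> X" using y f by auto
      ultimately show ?thesis using bb by (metis bij_betw_inv_into_left)
    qed
    ultimately show "inv\<^bsub>BijGroup X\<^esub> \<sigma> \<in> ?H"
      using f Bij_inv_into_mem[OF B] by (auto simp: comm restrict_inv_into_Bij[OF B] Pi_iff)
  next
    fix \<sigma> \<tau> assume "\<sigma> \<in> ?H" "\<tau> \<in> ?H"
    then show "\<sigma> \<otimes>\<^bsub>BijGroup X\<^esub> \<tau> \<in> ?H"
      using f Bij_imp_funcset[of \<tau> X]
      by (auto simp: BijGroup_def compose_Bij comm compose_eq Pi_iff)
  qed
  then show ?thesis
    unfolding Aut_def by (rule subgroup_imp_group)
qed

lemma group_semidirect_product:
  assumes "group N" "group H"
    and hom: "\<And>h. h \<in> carrier H \<Longrightarrow> \<phi> h \<in> hom N N"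
    and one: "\<And>n. n \<in> carrier N \<Longrightarrow> \<phi> \<one>\<^bsub>H\<^esub> n = n"
    and act: "\<And>h k n. h \<in> carrier H \<Longrightarrow> k \<in> carrier H \<Longrightarrow> n \<in> carrier N \<Longrightarrow>
               \<phi> (h \<otimes>\<^bsub>H\<^esub> k) n = \<phi> h (\<phi> k n)"
  shows "group (semidirect_product N H \<phi>)"
proof -
  interpret N: group N by fact
  interpret H: group H by fact
  have closed: "\<phi> h n \<in> carrier N" if "h \<in> carrier H" "n \<in> carrier N" for h n
    using hom[OF that(1)] that(2) by (auto simp: hom_def)
  have mult: "\<phi> h (n \<otimes>\<^bsub>N\<^esub> m) = \<phi> h n \<otimes>\<^bsub>N\<^esub> \<phi> h m"
    if "h \<in> carrier H" "n \<in> carrier N" "m \<in> carrier N" for h n m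
    using hom[OF that(1)] that(2,3) by (auto simp: hom_def)
  show ?thesis
  proof (rule groupI)
    fix x assume "x \<in> carrier (semidirect_product N H \<phi>)"
    then obtain n h where x: "x = (n, h)" "n \<in> carrier N" "h \<in> carrier H"
      by (auto simp: semidirect_product_def)
    have "(\<phi> (inv\<^bsub>H\<^esub> h) (inv\<^bsub>N\<^esub> n), inv\<^bsub>H\<^esub> h) \<otimes>\<^bsub>semidirect_product N H \<phi>\<^esub> x
        = (\<phi> (inv\<^bsub>H\<^esub> h) (inv\<^bsub>N\<^esub> n \<otimes>\<^bsub>N\<^esub> n), \<one>\<^bsub>H\<^esub>)"
      using x mult[of "inv\<^bsub>H\<^esub> h" "inv\<^bsub>N\<^esub> n" n]
      by (simp add: semidirect_product_def)
    also have "\<phi> (inv\<^bsub>H\<^esub> h) (inv\<^bsub>N\<^esub> n \<otimes>\<^bsub>N\<^esub> n) = \<one>\<^bsub>N\<^esub>"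
      using x hom_one[OF hom[of "inv\<^bsub>H\<^esub> h"] N.group_axioms N.group_axioms] by simp
    finally show "\<exists>y\<in>carrier (semidirect_product N H \<phi>).
        y \<otimes>\<^bsub>semidirect_product N H \<phi>\<^esub> x = \<one>\<^bsub>semidirect_product N H \<phi>\<^esub>"
      using x by (intro bexI[of _ "(\<phi> (inv\<^bsub>H\<^esub> h) (inv\<^bsub>N\<^esub> n), inv\<^bsub>H\<^esub> h)"])
        (auto simp: semidirect_product_def closed)
  qed (auto simp: semidirect_product_def closed one act mult N.m_assoc H.m_assoc)
qed

lemma group_wreath_product:
  assumes "group G"
  shows "group (wreath_product G C)"
proof -
  interpret group G by fact
  have inv_in: "inv_into C \<sigma> c \<in> C" if "\<sigma> \<in> Bij C" "c \<in> C" for \<sigma> c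
    using that by (rule Bij_inv_into_mem)
  show ?thesis
    unfolding wreath_product_def
  proof (rule group_semidirect_product)
    show "group (product_group C (\<lambda>_. G))" using assms by simp
    show "group (BijGroup C)" by (rule group_BijGroup)
  next
    fix \<sigma> assume "\<sigma> \<in> carrier (BijGroup C)"
    then have "\<sigma> \<in> Bij C" by (simp add: BijGroup_def)
    then show "permute_coords C \<sigma> \<in> hom (product_group C (\<lambda>_. G)) (product_group C (\<lambda>_. G))"
      by (auto simp: hom_def permute_coords_def inv_in PiE_iff fun_eq_iff)
  next
    fix a assume a: "a \<in> carrier (product_group C (\<lambda>_. G))"
    have "inv_into C (\<lambda>x\<in>C. x) c = c" if "c \<in> C" for c
      using that inv_into_f_f[of "\<lambda>x\<in>C. x" C c] by (auto simp: inj_on_def)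
    then show "permute_coords C \<one>\<^bsub>BijGroup C\<^esub> a = a"
      using a by (auto simp: BijGroup_def permute_coords_def PiE_iff extensional_def fun_eq_iff)
  next
    fix \<sigma> \<tau> a assume "\<sigma> \<in> carrier (BijGroup C)" "\<tau> \<in> carrier (BijGroup C)"
    then have B: "\<sigma> \<in> Bij C" "\<tau> \<in> Bij C" by (simp_all add: BijGroup_def)
    have "inv_into C (compose C \<sigma> \<tau>) c = inv_into C \<tau> (inv_into C \<sigma> c)" if c: "c \<in> C" for c
    proof (rule inv_into_f_eq)
      show "inj_on (compose C \<sigma> \<tau>) C"
        using compose_Bij[OF B] by (auto simp: Bij_def bij_betw_def)
      show "inv_into C \<tau> (inv_into C \<sigma> c) \<in> C" using B c by (simp add: inv_in)
      show "compose C \<sigma> \<tau> (inv_into C \<tau> (inv_into C \<sigma> c)) = c"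
        using B c inv_in[OF B(1) c] inv_in[OF B(2)]
          bij_betw_inv_into_right[of \<sigma> C C c] bij_betw_inv_into_right[of \<tau> C C]
        by (simp add: compose_eq Bij_def)
    qed
    then show "permute_coords C (\<sigma> \<otimes>\<^bsub>BijGroup C\<^esub> \<tau>) a = permute_coords C \<sigma> (permute_coords C \<tau> a)"
      using B by (auto simp: BijGroup_def permute_coords_def inv_in fun_eq_iff)
  qed
qed

end

theory Submission
  imports Defs
begin

text \<open>
  An automorphism of \<open>f\<close> is a permutation of \<open>X\<close> that commutes with \<open>f\<close>, so it carries each
  connected component of \<open>\<Gamma>\<^sub>f\<close> onto a connected component, and it restricts to an isomorphism
  between the two (\<open>Aut_permutes_components\<close>).  Hence it can move a component only inside its
  isomorphism class \<open>C\<^sub>i\<close>.  The unions \<open>Y\<^sub>i\<close> of the components in \<open>C\<^sub>i\<close> are therefore stable under all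
  automorphisms, and restricting to them splits \<open>Aut(f)\<close> into the product of the groups
  \<open>Aut(f|\<^sub>Y\<^sub>i)\<close> (\<open>Aut_stable_blocks_iso_product\<close>).

  Inside one \<open>Y\<^sub>i\<close>, fix an isomorphism \<open>\<theta>\<^sub>c\<close> from the representative onto each component \<open>c\<close>.  The
  points of \<open>Y\<^sub>i\<close> are then the values \<open>\<theta>\<^sub>c z\<close> with unique coordinates \<open>(c, z)\<close>, and an automorphism is
  exactly a permutation \<open>h\<close> of the components together with an automorphism \<open>a\<^sub>d\<close> of the
  representative for each target component \<open>d\<close>, acting by \<open>(c, z) \<mapsto> (h c, a\<^bsub>h c\<^esub> z)\<close>.  This is the
  wreath product (\<open>Aut_isomorphic_blocks_iso_wreath\<close>).

  Two translations connect this with the graph-theoretic data.  Two points lie in the same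
  component if and only if their forward orbits under \<open>f\<close> meet, a condition that commuting maps
  visibly preserve (\<open>component_vertex_sets_functional_digraph\<close>).  And although \<open>\<Gamma>\<^sub>f\<close> omits loops, it
  determines \<open>f\<close>: the fixed points are the vertices without an outgoing edge.  So isomorphisms of
  functional digraphs are the same as bijections that intertwine the functions
  (\<open>digraph_iso_functional_digraph_iff\<close>).
\<close>

section \<open>Automorphism groups of functions\<close>

lemma in_carrier_Aut_iff:
  "\<sigma> \<in> carrier (Aut X f) \<longleftrightarrow>
     \<sigma> \<in> extensional X \<and> bij_betw \<sigma> X X \<and> (\<forall>x\<in>X. \<sigma> (f x) = f (\<sigma> x))"
  by (auto simp: Aut_def Bij_def compose_def restrict_def fun_eq_iff)

lemma mult_Aut:
  "\<sigma> \<in> carrier (Aut X f) \<Longrightarrow> \<tau> \<in> carrier (Aut X f) \<Longrightarrow> \<sigma> \<otimes>\<^bsub>Aut X f\<^esub> \<tau> = compose X \<sigma> \<tau>"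
  by (auto simp: Aut_def BijGroup_def)

lemma one_Aut: "\<one>\<^bsub>Aut X f\<^esub> = (\<lambda>x\<in>X. x)"
  by (simp add: Aut_def BijGroup_def)

lemma Aut_mem: "\<sigma> \<in> carrier (Aut X f) \<Longrightarrow> x \<in> X \<Longrightarrow> \<sigma> x \<in> X"
  by (auto simp: in_carrier_Aut_iff bij_betw_apply)

lemma restrict_in_Aut:
  assumes \<sigma>: "\<sigma> \<in> carrier (Aut X f)" and Y: "Y \<subseteq> X" "\<sigma> ` Y = Y" "f \<in> Y \<rightarrow> Y"
  shows "restrict \<sigma> Y \<in> carrier (Aut Y f)"
proof -
  have "bij_betw \<sigma> Y Y"
    using \<sigma> Y by (auto simp: in_carrier_Aut_iff intro: bij_betw_subset)
  then have "bij_betw (restrict \<sigma> Y) Y Y" by simp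
  then show ?thesis
    using \<sigma> Y by (auto simp: in_carrier_Aut_iff)
qed

text \<open>Both homomorphisms below are described by actions of a group on points.  Bijectivity need not be
  checked separately for such an action: the inverse group element provides the inverse map.\<close>

lemma equivariant_action_in_hom_Aut:
  assumes G: "group G"
    and ext: "\<And>g. g \<in> carrier G \<Longrightarrow> \<Psi> g \<in> extensional X"
    and mem: "\<And>g x. g \<in> carrier G \<Longrightarrow> x \<in> X \<Longrightarrow> \<Psi> g x \<in> X"
    and comm: "\<And>g x. g \<in> carrier G \<Longrightarrow> x \<in> X \<Longrightarrow> \<Psi> g (f x) = f (\<Psi> g x)"
    and one: "\<And>x. x \<in> X \<Longrightarrow> \<Psi> \<one>\<^bsub>G\<^esub> x = x"
    and mult: "\<And>g h x. g \<in> carrier G \<Longrightarrow> h \<in> carrier G \<Longrightarrow> x \<in> X \<Longrightarrow>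
                 \<Psi> (g \<otimes>\<^bsub>G\<^esub> h) x = \<Psi> g (\<Psi> h x)"
  shows "\<Psi> \<in> hom G (Aut X f)"
proof (rule homI)
  interpret group G by fact
  show Aut: "\<Psi> g \<in> carrier (Aut X f)" if g: "g \<in> carrier G" for g
  proof -
    have "bij_betw (\<Psi> g) X X"
    proof (rule bij_betw_byWitness[where f' = "\<Psi> (inv\<^bsub>G\<^esub> g)"])
      show "\<forall>x\<in>X. \<Psi> (inv\<^bsub>G\<^esub> g) (\<Psi> g x) = x" "\<forall>x\<in>X. \<Psi> g (\<Psi> (inv\<^bsub>G\<^esub> g) x) = x"
        using g by (simp_all add: mult[symmetric] one)
    qed (use g mem in auto)
    then show ?thesis
      using g by (simp add: in_carrier_Aut_iff ext comm)
  qed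
  show "\<Psi> (g \<otimes>\<^bsub>G\<^esub> h) = \<Psi> g \<otimes>\<^bsub>Aut X f\<^esub> \<Psi> h" if "g \<in> carrier G" "h \<in> carrier G" for g h
    using that ext[of "g \<otimes>\<^bsub>G\<^esub> h"]
    by (auto simp: mult_Aut Aut compose_def restrict_def extensional_def fun_eq_iff mult)
qed


section \<open>Stable blocks give a direct product\<close>

text \<open>The map is built in the direction of gluing, from the product to \<open>Aut\<close>.  Automorphisms of the
  blocks act on disjoint sets and glue to an automorphism of the union; every automorphism arises
  this way, since it maps each block into itself and, being onto the union, also onto itself.\<close>

lemma Aut_stable_blocks_iso_product:
  fixes Y :: "'i \<Rightarrow> 'a set"
  assumes disj: "disjoint_family_on Y I"
    and f: "\<And>i. i \<in> I \<Longrightarrow> f \<in> Y i \<rightarrow> Y i"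
    and stable: "\<And>\<sigma> i. \<sigma> \<in> carrier (Aut (\<Union>i\<in>I. Y i) f) \<Longrightarrow> i \<in> I \<Longrightarrow> \<sigma> ` Y i \<subseteq> Y i"
  shows "Aut (\<Union>i\<in>I. Y i) f \<cong> product_group I (\<lambda>i. Aut (Y i) f)"
proof -
  let ?X = "\<Union>i\<in>I. Y i" and ?P = "product_group I (\<lambda>i. Aut (Y i) f)"
  have uniq: "i = j" if "i \<in> I" "j \<in> I" "x \<in> Y i" "x \<in> Y j" for i j x
    using disj that by (auto simp: disjoint_family_on_def)
  define idx where "idx x = (THE i. i \<in> I \<and> x \<in> Y i)" for x
  have idx: "idx x = i" if "i \<in> I" "x \<in> Y i" for i x
    unfolding idx_def using that uniq by (intro the_equality) auto
  define glue where "glue \<tau> = (\<lambda>x\<in>?X. \<tau> (idx x) x)" for \<tau> :: "'i \<Rightarrow> 'a \<Rightarrow> 'a"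
  have glue: "glue \<tau> x = \<tau> i x" if "i \<in> I" "x \<in> Y i" for \<tau> i x
    using that by (auto simp: glue_def idx)
  have grp: "group ?P" by (simp add: group_Aut f)
  have comp: "\<tau> i \<in> carrier (Aut (Y i) f)" if "\<tau> \<in> carrier ?P" "i \<in> I" for \<tau> i
    using that by auto
  have hom: "glue \<in> hom ?P (Aut ?X f)"
  proof (rule equivariant_action_in_hom_Aut[OF grp])
    fix \<tau> assume \<tau>: "\<tau> \<in> carrier ?P"
    show "glue \<tau> \<in> extensional ?X" by (simp add: glue_def)
    fix x assume "x \<in> ?X"
    then obtain i where i: "i \<in> I" "x \<in> Y i" by blast
    then have fi: "f x \<in> Y i" using f by auto
    show "glue \<tau> x \<in> ?X" using Aut_mem[OF comp[OF \<tau> i(1)] i(2)] i by (auto simp: glue[OF i])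
    show "glue \<tau> (f x) = f (glue \<tau> x)"
      using comp[OF \<tau> i(1)] i fi by (simp add: glue[OF i] glue[OF i(1) fi] in_carrier_Aut_iff)
  next
    fix x assume "x \<in> ?X"
    then obtain i where i: "i \<in> I" "x \<in> Y i" by blast
    show "glue \<one>\<^bsub>?P\<^esub> x = x" using i by (simp add: glue[OF i] one_Aut)
    fix \<tau> \<rho> assume \<tau>: "\<tau> \<in> carrier ?P" and \<rho>: "\<rho> \<in> carrier ?P"
    have "\<rho> i x \<in> Y i" using Aut_mem[OF comp[OF \<rho> i(1)] i(2)] .
    then show "glue (\<tau> \<otimes>\<^bsub>?P\<^esub> \<rho>) x = glue \<tau> (glue \<rho> x)"
      using i comp[OF \<tau> i(1)] comp[OF \<rho> i(1)]
      by (simp add: glue[OF i] glue[OF i(1)] mult_Aut compose_def)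
  qed
  have "inj_on glue (carrier ?P)"
  proof (rule inj_onI)
    fix \<tau> \<rho> assume \<tau>: "\<tau> \<in> carrier ?P" and \<rho>: "\<rho> \<in> carrier ?P" and eq: "glue \<tau> = glue \<rho>"
    have "\<tau> i = \<rho> i" if i: "i \<in> I" for i
    proof (rule extensionalityI[of _ "Y i"])
      show "\<tau> i \<in> extensional (Y i)" "\<rho> i \<in> extensional (Y i)"
        using comp[OF \<tau> i] comp[OF \<rho> i] by (auto simp: in_carrier_Aut_iff)
      show "\<tau> i x = \<rho> i x" if "x \<in> Y i" for x
        using eq glue[OF i that] by metis
    qed
    then show "\<tau> = \<rho>"
      using \<tau> \<rho> by (intro PiE_ext[of \<tau> I "\<lambda>i. carrier (Aut (Y i) f)"]) simp_all
  qed
  moreover have "carrier (Aut ?X f) \<subseteq> glue ` carrier ?P"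
  proof
    fix \<sigma> assume \<sigma>: "\<sigma> \<in> carrier (Aut ?X f)"
    then have bij: "bij_betw \<sigma> ?X ?X" by (simp add: in_carrier_Aut_iff)
    have im: "\<sigma> ` Y i = Y i" if i: "i \<in> I" for i
    proof
      show "\<sigma> ` Y i \<subseteq> Y i" using stable[OF \<sigma> i] .
      show "Y i \<subseteq> \<sigma> ` Y i"
      proof
        fix y assume y: "y \<in> Y i"
        then have "y \<in> \<sigma> ` ?X" using bij i by (auto simp: bij_betw_def)
        then obtain j x where j: "j \<in> I" "x \<in> Y j" "y = \<sigma> x" by blast
        then have "y \<in> Y j" using stable[OF \<sigma> j(1)] by blast
        then show "y \<in> \<sigma> ` Y i" using uniq[OF i j(1) y] j by blast
      qed
    qed
    let ?\<tau> = "\<lambda>i\<in>I. restrict \<sigma> (Y i)"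
    have "?\<tau> \<in> carrier ?P"
      using \<sigma> im f by (auto intro!: restrict_in_Aut[OF \<sigma>])
    moreover have "\<sigma> = glue ?\<tau>"
    proof (rule extensionalityI[of _ ?X])
      show "\<sigma> \<in> extensional ?X" using \<sigma> by (simp add: in_carrier_Aut_iff)
    qed (auto simp: glue_def idx)
    ultimately show "\<sigma> \<in> glue ` carrier ?P" by (rule rev_image_eqI[where f = glue])
  qed
  ultimately have "glue \<in> iso ?P (Aut ?X f)"
    using hom hom_carrier[OF hom] by (auto simp: iso_iff)
  then show ?thesis
    by (intro group.iso_sym[OF grp] is_isoI)
qed


section \<open>Permuted isomorphic blocks give a wreath product\<close>

text \<open>The model block \<open>Z\<close> gives coordinates \<open>\<theta> c z\<close> to the points of the union, and \<open>(a, h)\<close> acts by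
  \<open>\<theta> c z \<mapsto> \<theta> (h c) (a (h c) z)\<close>.  Indexing \<open>a\<close> by the target block rather than the source is what
  matches the multiplication \<open>(a, h) (a', h') = (a \<cdot> (a' \<circ> h\<inverse>), h h')\<close>: at the target \<open>h (h' c)\<close> the
  inner factor is \<open>a' (h' c)\<close>.  Non-emptiness of \<open>Z\<close> lets the action detect \<open>h\<close>.\<close>

lemma Aut_isomorphic_blocks_iso_wreath:
  fixes Y :: "'c \<Rightarrow> 'a set" and Z :: "'z set"
  assumes disj: "disjoint_family_on Y C"
    and g: "g \<in> Z \<rightarrow> Z" and ne: "Z \<noteq> {}"
    and \<theta>: "\<And>c. c \<in> C \<Longrightarrow> bij_betw (\<theta> c) Z (Y c)"
    and equiv: "\<And>c z. c \<in> C \<Longrightarrow> z \<in> Z \<Longrightarrow> \<theta> c (g z) = f (\<theta> c z)"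
    and blocks: "\<And>\<sigma> c. \<sigma> \<in> carrier (Aut (\<Union>c\<in>C. Y c) f) \<Longrightarrow> c \<in> C \<Longrightarrow> \<exists>d\<in>C. \<sigma> ` Y c = Y d"
  shows "Aut (\<Union>c\<in>C. Y c) f \<cong> wreath_product (Aut Z g) C"
proof -
  let ?X = "\<Union>c\<in>C. Y c" and ?W = "wreath_product (Aut Z g) C"
  have uniq: "c = d" if "c \<in> C" "d \<in> C" "x \<in> Y c" "x \<in> Y d" for c d x
    using disj that by (auto simp: disjoint_family_on_def)
  define blk where "blk x = (THE c. c \<in> C \<and> x \<in> Y c)" for x
  have blk: "blk x = c" if "c \<in> C" "x \<in> Y c" for c x
    unfolding blk_def using that uniq by (intro the_equality) auto
  have \<theta>_mem: "\<theta> c z \<in> Y c" if "c \<in> C" "z \<in> Z" for c z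
    using \<theta>[OF that(1)] that(2) by (rule bij_betw_apply)
  have coords: "\<exists>c\<in>C. \<exists>z\<in>Z. x = \<theta> c z" if "x \<in> ?X" for x
    using that \<theta> by (force simp: bij_betw_def)
  have \<theta>_eq: "c = d \<and> z = w" if "\<theta> c z = \<theta> d w" "c \<in> C" "d \<in> C" "z \<in> Z" "w \<in> Z" for c d z w
  proof -
    have "c = d" using uniq that \<theta>_mem by metis
    then show ?thesis using that \<theta>[of c] by (auto simp: bij_betw_def dest: inj_onD)
  qed
  have Y_ne: "Y c \<noteq> {}" if "c \<in> C" for c
    using \<theta>_mem[OF that] ne by blast
  define \<Psi> where "\<Psi> = (\<lambda>(a, h). \<lambda>x\<in>?X. \<theta> (h (blk x)) (a (h (blk x)) (inv_into Z (\<theta> (blk x)) x)))"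
  have \<Psi>: "\<Psi> (a, h) (\<theta> c z) = \<theta> (h c) (a (h c) z)" if "c \<in> C" "z \<in> Z" for a h c z
  proof -
    have "inv_into Z (\<theta> c) (\<theta> c z) = z"
      using \<theta>[OF that(1)] that(2) by (rule bij_betw_inv_into_left)
    then show ?thesis
      using \<theta>_mem[OF that] that by (auto simp: \<Psi>_def blk)
  qed
  have W: "(a, h) \<in> carrier ?W \<longleftrightarrow> a \<in> (\<Pi>\<^sub>E c\<in>C. carrier (Aut Z g)) \<and> h \<in> Bij C" for a h
    by (simp add: wreath_product_def semidirect_product_def BijGroup_def)
  have a_mem: "a c \<in> carrier (Aut Z g)" if "(a, h) \<in> carrier ?W" "c \<in> C" for a h c
    using that by (auto simp: W)
  have a_val: "a c z \<in> Z" if "(a, h) \<in> carrier ?W" "c \<in> C" "z \<in> Z" for a h c z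
    using Aut_mem[OF a_mem[OF that(1,2)] that(3)] .
  have h_mem: "h c \<in> C" if "(a, h) \<in> carrier ?W" "c \<in> C" for a h c
    using that by (auto simp: W dest: Bij_imp_funcset)
  have grp: "group ?W" by (intro group_wreath_product group_Aut g)
  have hom: "\<Psi> \<in> hom ?W (Aut ?X f)"
  proof (rule equivariant_action_in_hom_Aut[OF grp])
    fix w assume w: "w \<in> carrier ?W"
    obtain a h where ah: "w = (a, h)" by (cases w)
    note w = w[unfolded ah]
    show "\<Psi> w \<in> extensional ?X" by (simp add: \<Psi>_def ah)
    fix x assume "x \<in> ?X"
    then obtain c z where x: "c \<in> C" "z \<in> Z" "x = \<theta> c z" using coords by blast
    have gz: "g z \<in> Z" using g x by auto
    have hc: "h c \<in> C" using h_mem[OF w x(1)] .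
    show "\<Psi> w x \<in> ?X"
      using \<theta>_mem[OF hc a_val[OF w hc x(2)]] hc x by (auto simp: ah \<Psi>)
    have "a (h c) (g z) = g (a (h c) z)"
      using a_mem[OF w hc] x by (simp add: in_carrier_Aut_iff)
    then show "\<Psi> w (f x) = f (\<Psi> w x)"
      using x gz hc a_val[OF w hc x(2)] by (simp add: ah \<Psi> flip: equiv)
  next
    fix x assume "x \<in> ?X"
    then obtain c z where x: "c \<in> C" "z \<in> Z" "x = \<theta> c z" using coords by blast
    show "\<Psi> \<one>\<^bsub>?W\<^esub> x = x"
      using x by (simp add: wreath_product_def semidirect_product_def BijGroup_def \<Psi> one_Aut)
    fix w w' assume w: "w \<in> carrier ?W" and w': "w' \<in> carrier ?W"
    obtain a h a' h' where ah: "w = (a, h)" "w' = (a', h')" by (cases w, cases w')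
    note w = w[unfolded ah] and w' = w'[unfolded ah]
    have hB: "h \<in> Bij C" "h' \<in> Bij C" using w w' by (auto simp: W)
    let ?d = "h' c"
    have d: "?d \<in> C" "h ?d \<in> C" using h_mem w w' x by auto
    have inv: "inv_into C h (h ?d) = ?d"
      using hB d by (auto simp: Bij_def bij_betw_inv_into_left)
    have "w \<otimes>\<^bsub>?W\<^esub> w' = ((\<lambda>c\<in>C. a c \<otimes>\<^bsub>Aut Z g\<^esub> permute_coords C h a' c), compose C h h')"
      using hB by (simp add: ah wreath_product_def semidirect_product_def BijGroup_def)
    then have "\<Psi> (w \<otimes>\<^bsub>?W\<^esub> w') x = \<theta> (h ?d) ((a (h ?d) \<otimes>\<^bsub>Aut Z g\<^esub> a' ?d) z)"
      using x d by (simp add: \<Psi> compose_def permute_coords_def inv)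
    also have "\<dots> = \<theta> (h ?d) (a (h ?d) (a' ?d z))"
      using a_mem[OF w d(2)] a_mem[OF w' d(1)] x by (simp add: mult_Aut compose_def)
    also have "\<dots> = \<Psi> w (\<Psi> w' x)"
      using x d a_val[OF w' d(1)] by (simp add: ah \<Psi>)
    finally show "\<Psi> (w \<otimes>\<^bsub>?W\<^esub> w') x = \<Psi> w (\<Psi> w' x)" .
  qed
  have "inj_on \<Psi> (carrier ?W)"
  proof (rule inj_onI)
    fix w w' assume w: "w \<in> carrier ?W" and w': "w' \<in> carrier ?W" and eq: "\<Psi> w = \<Psi> w'"
    obtain a h a' h' where ah: "w = (a, h)" "w' = (a', h')" by (cases w, cases w')
    note w = w[unfolded ah] and w' = w'[unfolded ah]
    have *: "h c = h' c \<and> a (h c) z = a' (h' c) z" if "c \<in> C" "z \<in> Z" for c z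
      using eq \<Psi>[OF that, of a h] \<Psi>[OF that, of a' h'] that h_mem w w' a_val
      by (intro \<theta>_eq) (auto simp: ah)
    have hB: "h \<in> Bij C" "h' \<in> Bij C" using w w' by (auto simp: W)
    have h: "h = h'"
      using hB * ne by (intro extensionalityI[of _ C]) (auto dest: Bij_imp_extensional)
    have "a d = a' d" if d: "d \<in> C" for d
    proof (rule extensionalityI[of _ Z])
      show "a d \<in> extensional Z" "a' d \<in> extensional Z"
        using a_mem[OF w d] a_mem[OF w' d] by (auto simp: in_carrier_Aut_iff)
      obtain c where "c \<in> C" "d = h c"
        using hB(1) d by (auto simp: Bij_def bij_betw_def)
      then show "a d z = a' d z" if "z \<in> Z" for z
        using * that h by auto
    qed
    then have "a = a'" 
      using w w' by (intro PiE_ext[of a C "\<lambda>_. carrier (Aut Z g)"]) (simp_all add: W)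
    then show "w = w'" by (simp add: ah h)
  qed
  moreover have "carrier (Aut ?X f) \<subseteq> \<Psi> ` carrier ?W"
  proof
    fix \<sigma> assume \<sigma>: "\<sigma> \<in> carrier (Aut ?X f)"
    then have bij: "bij_betw \<sigma> ?X ?X" and comm: "\<And>x. x \<in> ?X \<Longrightarrow> \<sigma> (f x) = f (\<sigma> x)"
      and ext: "\<sigma> \<in> extensional ?X" by (auto simp: in_carrier_Aut_iff)
    obtain h0 where h0: "\<And>c. c \<in> C \<Longrightarrow> h0 c \<in> C \<and> \<sigma> ` Y c = Y (h0 c)"
      using blocks[OF \<sigma>] by metis
    \<comment> \<open>Elements of \<^const>\<open>Bij\<close> are extensional, so the choice function is cut down to \<open>C\<close>.\<close>
    define h where "h = restrict h0 C"
    have h: "h c \<in> C" "\<sigma> ` Y c = Y (h c)" if "c \<in> C" for c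
      using h0 that by (auto simp: h_def)
    have "bij_betw h C C"
      unfolding bij_betw_def
    proof
      show "inj_on h C"
      proof (rule inj_onI)
        fix c d assume c: "c \<in> C" and d: "d \<in> C" and "h c = h d"
        then have "\<sigma> ` Y c = \<sigma> ` Y d" using h by simp
        then have "Y c = Y d"
          using bij c d by (subst (asm) inj_on_image_eq_iff[of \<sigma> ?X]) (auto simp: bij_betw_def)
        then show "c = d" using uniq[OF c d] Y_ne[OF c] by blast
      qed
      show "h ` C = C"
      proof
        show "h ` C \<subseteq> C" using h by blast
        show "C \<subseteq> h ` C"
        proof
          fix d assume d: "d \<in> C"
          then obtain y where y: "y \<in> Y d" using Y_ne by blast
          then have "y \<in> \<sigma> ` ?X" using bij d by (auto simp: bij_betw_def)
          then obtain c where "c \<in> C" "y \<in> \<sigma> ` Y c" by blast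
          then have "d = h c" using uniq[OF d _ y] h by blast
          then show "d \<in> h ` C" using \<open>c \<in> C\<close> by blast
        qed
      qed
    qed
    then have hB: "h \<in> Bij C" by (simp add: Bij_def h_def)
    \<comment> \<open>The only candidate: \<open>\<sigma>\<close> from the block \<open>h\<inverse> d\<close> to the block \<open>d\<close>, read in the coordinates of \<open>Z\<close>.\<close>
    define a where "a = (\<lambda>d\<in>C. \<lambda>z\<in>Z. inv_into Z (\<theta> d) (\<sigma> (\<theta> (inv_into C h d) z)))"
    have a: "a (h c) z = inv_into Z (\<theta> (h c)) (\<sigma> (\<theta> c z))" if "c \<in> C" "z \<in> Z" for c z
      using that h \<open>bij_betw h C C\<close> by (simp add: a_def bij_betw_inv_into_left)
    have \<theta>a: "\<theta> (h c) (a (h c) z) = \<sigma> (\<theta> c z)" if "c \<in> C" "z \<in> Z" for c z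
      using that h[OF that(1)] \<theta>_mem[OF that]
      by (auto simp: a intro!: bij_betw_inv_into_right[OF \<theta>])
    have "a d \<in> carrier (Aut Z g)" if "d \<in> C" for d
    proof -
      obtain c where c: "c \<in> C" "d = h c"
        using \<open>bij_betw h C C\<close> \<open>d \<in> C\<close> by (metis bij_betw_imp_surj_on imageE)
      have "bij_betw \<sigma> (Y c) (Y d)"
        using bij_betw_subset[OF bij, of "Y c"] c h by auto
      then have "bij_betw (inv_into Z (\<theta> d) \<circ> (\<sigma> \<circ> \<theta> c)) Z Z"
        by (rule bij_betw_trans[OF bij_betw_trans[OF \<theta>[OF c(1)]] bij_betw_inv_into[OF \<theta>[OF that]]])
      then have bija: "bij_betw (a d) Z Z"
        by (subst bij_betw_cong[where g = "inv_into Z (\<theta> d) \<circ> (\<sigma> \<circ> \<theta> c)"]) (auto simp: a c)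
      have "a d (g z) = g (a d z)" if z: "z \<in> Z" for z
      proof -
        have gz: "g z \<in> Z" using g z by auto
        have az: "a d z \<in> Z" "a d (g z) \<in> Z"
          using bij_betw_apply[OF bija] z gz by blast+
        have "\<theta> c z \<in> ?X" using c(1) \<theta>_mem[OF c(1) z] by blast
        then have "\<theta> d (a d (g z)) = f (\<sigma> (\<theta> c z))"
          using c z gz comm by (simp add: \<theta>a equiv)
        also have "\<dots> = \<theta> d (g (a d z))"
          using that az \<theta>a[OF c(1) z] c \<open>d \<in> C\<close> by (simp add: equiv)
        finally show ?thesis
          using \<theta>_eq \<open>d \<in> C\<close> az g by blast
      qed
      then show ?thesis
        using bija \<open>d \<in> C\<close> by (simp add: in_carrier_Aut_iff) (simp add: a_def)
    qed
    then have W: "(a, h) \<in> carrier ?W" using hB by (auto simp: W a_def)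
    moreover have "\<sigma> = \<Psi> (a, h)"
    proof (rule extensionalityI[of _ ?X])
      show "\<sigma> x = \<Psi> (a, h) x" if "x \<in> ?X" for x
        using coords[OF that] by (auto simp: \<Psi> \<theta>a)
    qed (use ext in \<open>auto simp: \<Psi>_def\<close>)
    ultimately show "\<sigma> \<in> \<Psi> ` carrier ?W" by (rule rev_image_eqI[where f = \<Psi>])
  qed
  ultimately have "\<Psi> \<in> iso ?W (Aut ?X f)"
    using hom hom_carrier[OF hom] by (auto simp: iso_iff)
  then show ?thesis
    by (intro group.iso_sym[OF grp] is_isoI)
qed


section \<open>Components of the functional digraph\<close>

definition orbits_meet :: "('a \<Rightarrow> 'a) \<Rightarrow> 'a \<Rightarrow> 'a \<Rightarrow> bool" where
  "orbits_meet f x y \<longleftrightarrow> (\<exists>m n. (f ^^ m) x = (f ^^ n) y)"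

lemma orbits_meet_refl: "orbits_meet f x x"
  unfolding orbits_meet_def by blast

lemma orbits_meet_step: "orbits_meet f x (f x)"
proof -
  have "(f ^^ 1) x = (f ^^ 0) (f x)" by simp
  then show ?thesis unfolding orbits_meet_def by blast
qed

lemma orbits_meet_sym: "orbits_meet f x y \<Longrightarrow> orbits_meet f y x"
  unfolding orbits_meet_def by metis

lemma orbits_meet_trans:
  assumes "orbits_meet f x y" "orbits_meet f y z"
  shows "orbits_meet f x z"
proof -
  obtain m n k l where mn: "(f ^^ m) x = (f ^^ n) y" and kl: "(f ^^ k) y = (f ^^ l) z"
    using assms unfolding orbits_meet_def by blast
  have "(f ^^ (k + m)) x = (f ^^ (k + n)) y" by (simp add: funpow_add mn)
  also have "\<dots> = (f ^^ (n + l)) z" by (simp add: funpow_add kl add.commute[of k])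
  finally show ?thesis unfolding orbits_meet_def by blast
qed

lemma funpow_mem: "f \<in> X \<rightarrow> X \<Longrightarrow> x \<in> X \<Longrightarrow> (f ^^ n) x \<in> X"
  by (induction n) auto

text \<open>Every point is joined to its whole forward orbit, so points with meeting orbits are connected.
  Conversely the two ends of an edge have meeting orbits, and this relation is transitive because
  two orbits that meet a common third one both contain a tail of it.\<close>

lemma component_vertex_sets_functional_digraph:
  assumes f: "f \<in> X \<rightarrow> X"
  shows "component_vertex_sets (functional_digraph X f) = (\<lambda>x. {y \<in> X. orbits_meet f x y}) ` X"
proof -
  let ?G = "functional_digraph X f"
  let ?M = "mk_symmetric ?G"
  interpret H: wf_digraph ?M
    using f by unfold_locales (auto simp: parcs_mk_symmetric functional_digraph_def)
  have verts: "verts ?M = X" by (simp add: functional_digraph_def)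
  have adj: "x \<rightarrow>\<^bsub>?M\<^esub> y \<longleftrightarrow> x \<noteq> y \<and> (x \<in> X \<and> y = f x \<or> y \<in> X \<and> x = f y)" for x y
    by (auto simp: parcs_mk_symmetric functional_digraph_def)
  have refl: "x \<rightarrow>\<^sup>*\<^bsub>?M\<^esub> x" if "x \<in> X" for x
    using that verts by (intro H.reachable_refl) simp
  have step: "x \<rightarrow>\<^sup>*\<^bsub>?M\<^esub> f x \<and> f x \<rightarrow>\<^sup>*\<^bsub>?M\<^esub> x" if "x \<in> X" for x
  proof (cases "x = f x")
    case True
    then show ?thesis using refl[OF that] by simp
  next
    case False
    then have "x \<rightarrow>\<^bsub>?M\<^esub> f x" "f x \<rightarrow>\<^bsub>?M\<^esub> x"
      unfolding adj using that by auto
    then show ?thesis by (intro conjI H.reachable_adjI)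
  qed
  have orbit: "x \<rightarrow>\<^sup>*\<^bsub>?M\<^esub> (f ^^ n) x \<and> (f ^^ n) x \<rightarrow>\<^sup>*\<^bsub>?M\<^esub> x" if "x \<in> X" for x n
  proof (induction n)
    case 0
    show ?case using refl[OF that] by simp
  next
    case (Suc n)
    then show ?case
      using step[OF funpow_mem[OF f that, of n]] by (auto intro: H.reachable_trans)
  qed
  have reach: "x \<rightarrow>\<^sup>*\<^bsub>?M\<^esub> y \<longleftrightarrow> x \<in> X \<and> y \<in> X \<and> orbits_meet f x y" for x y
  proof
    assume r: "x \<rightarrow>\<^sup>*\<^bsub>?M\<^esub> y"
    then have "orbits_meet f x y"
    proof (induction rule: H.reachable_induct)
      case base
      show ?case by (rule orbits_meet_refl)
    next
      case (step y z)
      then have "orbits_meet f y z"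
        using orbits_meet_step orbits_meet_sym by (metis adj)
      then show ?case using step orbits_meet_trans by metis
    qed
    then show "x \<in> X \<and> y \<in> X \<and> orbits_meet f x y"
      using H.reachable_in_verts[OF r] by (simp add: functional_digraph_def)
  next
    assume "x \<in> X \<and> y \<in> X \<and> orbits_meet f x y"
    then show "x \<rightarrow>\<^sup>*\<^bsub>?M\<^esub> y"
      using orbit by (auto simp: orbits_meet_def) (metis H.reachable_trans)
  qed
  have "component_vertex_sets ?G = H.scc_of ` X"
    unfolding component_vertex_sets_def
    using H.sccs_verts_conv H.sccs_verts_conv_scc_of verts by simp
  also have "\<dots> = (\<lambda>x. {y \<in> X. orbits_meet f x y}) ` X"
    using orbits_meet_sym by (intro image_cong) (auto simp: H.scc_of_def reach)
  finally show ?thesis .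
qed

text \<open>An automorphism and its inverse preserve the relation that two orbits meet.  Within an invariant
  disjoint family whose members are connected, this relation is membership in the same block, so
  the image of a block is again a whole block.\<close>

lemma Aut_permutes_components:
  assumes disj: "disjoint_family_on Y C"
    and f: "\<And>c. c \<in> C \<Longrightarrow> f \<in> Y c \<rightarrow> Y c" and ne: "\<And>c. c \<in> C \<Longrightarrow> Y c \<noteq> {}"
    and conn: "\<And>c x y. c \<in> C \<Longrightarrow> x \<in> Y c \<Longrightarrow> y \<in> Y c \<Longrightarrow> orbits_meet f x y"
    and \<sigma>: "\<sigma> \<in> carrier (Aut (\<Union>c\<in>C. Y c) f)" and c: "c \<in> C"
  shows "\<exists>d\<in>C. \<sigma> ` Y c = Y d"
proof -
  let ?X = "\<Union>c\<in>C. Y c"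
  have bij: "bij_betw \<sigma> ?X ?X" and comm: "\<And>x. x \<in> ?X \<Longrightarrow> \<sigma> (f x) = f (\<sigma> x)"
    using \<sigma> by (auto simp: in_carrier_Aut_iff)
  have fX: "f \<in> ?X \<rightarrow> ?X" using f by blast
  have pow: "\<sigma> ((f ^^ n) x) = (f ^^ n) (\<sigma> x)" if "x \<in> ?X" for n x
    by (induction n) (use that comm funpow_mem[OF fX that] in auto)
  have meet: "orbits_meet f (\<sigma> x) (\<sigma> y) \<longleftrightarrow> orbits_meet f x y" if x: "x \<in> ?X" and y: "y \<in> ?X" for x y
  proof -
    have "\<sigma> ((f ^^ m) x) = \<sigma> ((f ^^ n) y) \<longleftrightarrow> (f ^^ m) x = (f ^^ n) y" for m n
      using bij funpow_mem[OF fX x] funpow_mem[OF fX y] by (auto simp: bij_betw_def dest: inj_onD)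
    then show ?thesis
      unfolding orbits_meet_def by (simp add: pow[OF x, symmetric] pow[OF y, symmetric])
  qed
  have same: "y \<in> Y d" if xy: "orbits_meet f x y" and d: "d \<in> C" "x \<in> Y d" and y: "y \<in> ?X" for x y d
  proof -
    obtain m n where mn: "(f ^^ m) x = (f ^^ n) y" using xy unfolding orbits_meet_def by blast
    obtain e where e: "e \<in> C" "y \<in> Y e" using y by blast
    have "(f ^^ n) y \<in> Y d \<inter> Y e"
      using funpow_mem[OF f[OF d(1)] d(2), of m] funpow_mem[OF f[OF e(1)] e(2), of n] mn by simp
    then have "d = e" using disj d(1) e(1) by (auto simp: disjoint_family_on_def)
    then show ?thesis using e by simp
  qed
  obtain x where x: "x \<in> Y c" using ne[OF c] by blast
  then have xX: "x \<in> ?X" using c by blast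
  then obtain d where d: "d \<in> C" "\<sigma> x \<in> Y d" using Aut_mem[OF \<sigma>] by blast
  have "\<sigma> ` Y c = Y d"
  proof
    show "\<sigma> ` Y c \<subseteq> Y d"
    proof
      fix z assume "z \<in> \<sigma> ` Y c"
      then obtain y where y: "y \<in> Y c" "z = \<sigma> y" by blast
      then have yX: "y \<in> ?X" using c by blast
      have "orbits_meet f (\<sigma> x) (\<sigma> y)" using meet[OF xX yX] conn[OF c x y(1)] by simp
      then show "z \<in> Y d" using same d y Aut_mem[OF \<sigma> yX] by blast
    qed
    show "Y d \<subseteq> \<sigma> ` Y c"
    proof
      fix z assume z: "z \<in> Y d"
      then have "z \<in> \<sigma> ` ?X" using bij d by (auto simp: bij_betw_def)
      then obtain y where y: "y \<in> ?X" "z = \<sigma> y" by blast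
      then have "orbits_meet f x y" using meet[OF xX y(1)] conn[OF d(1) d(2) z] by simp
      then show "z \<in> \<sigma> ` Y c" using same[OF _ c x y(1)] y by blast
    qed
  qed
  then show ?thesis using d by blast
qed


section \<open>Isomorphism of functional digraphs\<close>

text \<open>At a point that is not fixed, the single outgoing edge records the value of the function.  At a
  fixed point there is no outgoing edge; an isomorphism preserves this as well, so its image is
  fixed too.\<close>

lemma digraph_iso_functional_digraph_iff:
  assumes f: "f \<in> X \<rightarrow> X" and g: "g \<in> Y \<rightarrow> Y"
  shows "digraph_iso (functional_digraph X f) (functional_digraph Y g) \<longleftrightarrow>
           (\<exists>\<theta>. bij_betw \<theta> X Y \<and> (\<forall>x\<in>X. \<theta> (f x) = g (\<theta> x)))"
    (is "?L \<longleftrightarrow> ?R")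
proof
  let ?F = "functional_digraph X f" and ?G = "functional_digraph Y g"
  have wf: "wf_digraph ?F"
    using f by unfold_locales (auto simp: functional_digraph_def)
  {
    assume ?L
    then obtain \<phi> where \<phi>: "pre_digraph.digraph_isomorphism ?F \<phi>" and G: "?G = app_iso \<phi> ?F"
      unfolding digraph_iso_def by blast
    let ?\<theta> = "iso_verts \<phi>"
    have vX: "verts ?F = X" and vY: "verts ?G = Y"
      and aF: "\<And>x y. (x, y) \<in> arcs ?F \<longleftrightarrow> x \<in> X \<and> y = f x \<and> x \<noteq> y"
      and aG: "\<And>x y. (x, y) \<in> arcs ?G \<longleftrightarrow> x \<in> Y \<and> y = g x \<and> x \<noteq> y"
      and tF: "tail ?F = fst" "head ?F = snd" and tG: "tail ?G = fst" "head ?G = snd"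
      by (auto simp: functional_digraph_def)
    have inj: "inj_on ?\<theta> X"
      using \<phi> vX by (auto simp: pre_digraph.digraph_isomorphism_def)
    have im: "?\<theta> ` X = Y" using vX vY G by (metis verts_app_iso)
    have arcs_im: "iso_arcs \<phi> ` arcs ?F = arcs ?G" using G by simp
    have ends: "iso_arcs \<phi> (x, y) = (?\<theta> x, ?\<theta> y)" if "(x, y) \<in> arcs ?F" for x y
    proof -
      have "?\<theta> x = fst (iso_arcs \<phi> (x, y))" "?\<theta> y = snd (iso_arcs \<phi> (x, y))"
        using \<phi> that tF tG G by (auto simp: pre_digraph.digraph_isomorphism_def)
      then show ?thesis by simp
    qed
    have "?\<theta> (f x) = g (?\<theta> x)" if x: "x \<in> X" for x
    proof (cases "f x = x")
      case False
      then have "(x, f x) \<in> arcs ?F" using x by (simp add: aF)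
      then have "(?\<theta> x, ?\<theta> (f x)) \<in> arcs ?G" using ends arcs_im by (metis imageI)
      then show ?thesis by (simp add: aG)
    next
      case True
      have "g (?\<theta> x) = ?\<theta> x"
      proof (rule ccontr)
        assume "g (?\<theta> x) \<noteq> ?\<theta> x"
        then have "(?\<theta> x, g (?\<theta> x)) \<in> arcs ?G" using x im by (auto simp: aG)
        then obtain u v where uv: "(u, v) \<in> arcs ?F" "?\<theta> u = ?\<theta> x"
        proof -
          assume "(?\<theta> x, g (?\<theta> x)) \<in> arcs ?G"
          then obtain e where e: "e \<in> arcs ?F" "iso_arcs \<phi> e = (?\<theta> x, g (?\<theta> x))"
            unfolding arcs_im[symmetric] by force
          then show thesis using ends[of "fst e" "snd e"] by (intro that[of "fst e" "snd e"]) auto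
        qed
        then have "u = x" using inj x by (auto simp: aF dest: inj_onD)
        then show False using uv True by (auto simp: aF)
      qed
      then show ?thesis using True by simp
    qed
    then show ?R using inj im by (auto simp: bij_betw_def)
  next
    assume ?R
    then obtain \<theta> where bij: "bij_betw \<theta> X Y" and eq: "\<And>x. x \<in> X \<Longrightarrow> \<theta> (f x) = g (\<theta> x)" by blast
    then have inj: "inj_on \<theta> X" and im: "\<theta> ` X = Y" by (auto simp: bij_betw_def)
    \<comment> \<open>Injectivity makes \<open>\<theta>\<close> reflect fixed points, so the omitted loops correspond.\<close>
    have fix_iff: "\<theta> x = \<theta> (f x) \<longleftrightarrow> x = f x" if "x \<in> X" for x
      using inj that f by (auto dest: inj_onD)
    let ?\<phi> = "\<lparr>iso_verts = \<theta>, iso_arcs = map_prod \<theta> \<theta>, iso_head = snd, iso_tail = fst\<rparr>"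
    have "inj_on (map_prod \<theta> \<theta>) (X \<times> X)" using inj by (simp add: map_prod_inj_on)
    then have "inj_on (map_prod \<theta> \<theta>) (arcs ?F)"
      by (rule inj_on_subset) (use f in \<open>auto simp: functional_digraph_def\<close>)
    then have "pre_digraph.digraph_isomorphism ?F ?\<phi>"
      using wf inj by (auto simp: pre_digraph.digraph_isomorphism_def functional_digraph_def)
    moreover have "map_prod \<theta> \<theta> ` arcs ?F = arcs ?G"
    proof -
      have "arcs ?F = (\<lambda>x. (x, f x)) ` {x \<in> X. x \<noteq> f x}"
        "arcs ?G = (\<lambda>y. (y, g y)) ` {y \<in> Y. y \<noteq> g y}"
        by (auto simp: functional_digraph_def)
      moreover have "{y \<in> Y. y \<noteq> g y} = \<theta> ` {x \<in> X. x \<noteq> f x}"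
        using eq fix_iff by (auto simp flip: im)
      ultimately show ?thesis by (auto simp: image_image eq intro!: image_cong)
    qed
    then have "?G = app_iso ?\<phi> ?F"
      using im by (intro pre_digraph.equality) (auto simp: functional_digraph_def)
    ultimately show ?L unfolding digraph_iso_def by blast
  }
qed


section \<open>Coarsest partitions\<close>

text \<open>The classes of an equivalence relation \<open>r\<close> form one partition into mutually related elements, so
  they refine the coarsest one.  Hence the blocks of the latter are full equivalence classes.\<close>

lemma coarsest_partition_on_related_mem:
  assumes P: "coarsest_partition_on S (\<lambda>P. \<forall>B\<in>P. \<forall>s\<in>B. \<forall>t\<in>B. r s t) P"
    and refl: "\<And>s. s \<in> S \<Longrightarrow> r s s"
    and sym: "\<And>s t. s \<in> S \<Longrightarrow> t \<in> S \<Longrightarrow> r s t \<Longrightarrow> r t s"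
    and trans: "\<And>s t u. s \<in> S \<Longrightarrow> t \<in> S \<Longrightarrow> u \<in> S \<Longrightarrow> r s t \<Longrightarrow> r t u \<Longrightarrow> r s u"
    and B: "B \<in> P" "s \<in> B" and t: "t \<in> S" "r s t"
  shows "t \<in> B"
proof -
  let ?R = "{(s, t). s \<in> S \<and> t \<in> S \<and> r s t}"
  have part: "partition_on S P" using P by (simp add: coarsest_partition_on_def)
  have s: "s \<in> S" using part B by (auto simp: partition_on_def)
  have eq: "equiv S ?R"
    using refl sym trans by (intro equivI refl_onI symI transI) blast+
  have "partition_on S (S // ?R)"
    using eq by (rule partition_on_quotient)
  moreover have "\<forall>B\<in>S // ?R. \<forall>s\<in>B. \<forall>t\<in>B. r s t"
    using quotient_eq_iff[OF eq] by (auto dest: in_quotient_imp_in_rel[OF eq])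
  ultimately have "refines S (S // ?R) P"
    using P by (auto simp: coarsest_partition_on_def)
  moreover have "?R `` {s} \<in> S // ?R" using s by (rule quotientI)
  ultimately obtain B' where B': "B' \<in> P" "?R `` {s} \<subseteq> B'"
    unfolding refines_def by blast
  then have "s \<in> B'" "t \<in> B'" using s t refl by auto
  then show ?thesis
    using part B B' by (auto simp: partition_on_def disjoint_def)
qed


section \<open>The decomposition\<close>

theorem proposition4p6:
  fixes X :: "'a set" and f :: "'a \<Rightarrow> 'a"
    and S :: "'s set" and Xs :: "'s \<Rightarrow> 'a set"
    and I :: "'i set" and C :: "'i \<Rightarrow> 's set" and rep :: "'i \<Rightarrow> 's"
  assumes "X \<noteq> {}"
    and "f \<in> X \<rightarrow> X"
    and "bij_betw Xs S (component_vertex_sets (functional_digraph X f))"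
    and "inj_on C I"
    and "coarsest_partition_on S
           (\<lambda>P. \<forall>B\<in>P. \<forall>s\<in>B. \<forall>t\<in>B.
              digraph_iso (functional_digraph (Xs s) (restrict f (Xs s)))
                          (functional_digraph (Xs t) (restrict f (Xs t))))
           (C ` I)"
    and "\<forall>i\<in>I. rep i \<in> C i"
  shows "Aut X f \<cong>
         product_group I (\<lambda>i. wreath_product (Aut (Xs (rep i)) (restrict f (Xs (rep i)))) (C i))"
proof -
  let ?\<Gamma> = "\<lambda>s. functional_digraph (Xs s) (restrict f (Xs s))"
  have XsS: "Xs ` S = (\<lambda>x. {y \<in> X. orbits_meet f x y}) ` X" and injX: "inj_on Xs S"
    using assms(3) component_vertex_sets_functional_digraph[OF assms(2)]
    by (auto simp: bij_betw_def)
  have comp: "\<exists>x\<in>X. Xs s = {y \<in> X. orbits_meet f x y}" if "s \<in> S" for s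
    using XsS that by blast
  have Xs_ne: "Xs s \<noteq> {}" if s: "s \<in> S" for s
  proof -
    obtain x where "x \<in> X" "Xs s = {y \<in> X. orbits_meet f x y}" using comp[OF s] by blast
    then have "x \<in> Xs s" by (simp add: orbits_meet_refl)
    then show ?thesis by blast
  qed
  have Xs_f: "f \<in> Xs s \<rightarrow> Xs s" if s: "s \<in> S" for s
  proof
    fix y assume y: "y \<in> Xs s"
    obtain x where x: "Xs s = {y \<in> X. orbits_meet f x y}" using comp[OF s] by blast
    then show "f y \<in> Xs s"
      using y assms(2) orbits_meet_trans[OF _ orbits_meet_step] by auto
  qed
  have Xs_conn: "orbits_meet f y z" if s: "s \<in> S" and y: "y \<in> Xs s" and z: "z \<in> Xs s" for s y z
  proof -
    obtain x where x: "Xs s = {y \<in> X. orbits_meet f x y}" using comp[OF s] by blast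
    then show ?thesis
      using y z by (intro orbits_meet_trans[of f y x z] orbits_meet_sym[of f x y]) auto
  qed
  have Un: "(\<Union>s\<in>S. Xs s) = X"
    unfolding XsS by (auto intro: orbits_meet_refl)
  have disj: "disjoint_family_on Xs S"
    unfolding disjoint_family_on_def
  proof (intro ballI impI)
    fix s t assume s: "s \<in> S" and t: "t \<in> S" and "s \<noteq> t"
    then have "Xs s \<noteq> Xs t" using injX by (auto dest: inj_onD)
    moreover have "Xs s = Xs t" if z: "z \<in> Xs s" "z \<in> Xs t" for z
    proof -
      obtain x y where xy: "Xs s = {v \<in> X. orbits_meet f x v}" "Xs t = {v \<in> X. orbits_meet f y v}"
        using comp[OF s] comp[OF t] by blast
      then have "orbits_meet f x z" "orbits_meet f y z" using z by auto
      then have "orbits_meet f x y" "orbits_meet f y x"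
        using orbits_meet_trans orbits_meet_sym by metis+
      then show ?thesis
        unfolding xy using orbits_meet_trans by metis
    qed
    ultimately show "Xs s \<inter> Xs t = {}" by blast
  qed

  let ?conj = "\<lambda>s t \<theta>. bij_betw \<theta> (Xs s) (Xs t) \<and> (\<forall>x\<in>Xs s. \<theta> (f x) = f (\<theta> x))"
  have iso_iff: "digraph_iso (?\<Gamma> s) (?\<Gamma> t) \<longleftrightarrow> (\<exists>\<theta>. ?conj s t \<theta>)" if s: "s \<in> S" and t: "t \<in> S" for s t
  proof -
    have eqv: "(\<forall>x\<in>Xs s. \<theta> (restrict f (Xs s) x) = restrict f (Xs t) (\<theta> x)) \<longleftrightarrow>
            (\<forall>x\<in>Xs s. \<theta> (f x) = f (\<theta> x))" if "bij_betw \<theta> (Xs s) (Xs t)" for \<theta>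
      using bij_betw_apply[OF that] by auto
    have "restrict f (Xs s) \<in> Xs s \<rightarrow> Xs s" "restrict f (Xs t) \<in> Xs t \<rightarrow> Xs t"
      using Xs_f s t by auto
    then show ?thesis
      by (simp only: digraph_iso_functional_digraph_iff eqv cong: conj_cong)
  qed
  have part: "partition_on S (C ` I)"
    using assms(5) by (simp add: coarsest_partition_on_def)
  have CS: "C i \<subseteq> S" if "i \<in> I" for i using part that by (auto simp: partition_on_def)
  have C_iso: "digraph_iso (?\<Gamma> s) (?\<Gamma> t)" if "i \<in> I" "s \<in> C i" "t \<in> C i" for i s t
    using assms(5) that by (auto simp: coarsest_partition_on_def)
  \<comment> \<open>By coarseness, the blocks \<open>C i\<close> are full isomorphism classes of components.\<close>
  have C_closed: "t \<in> C i" if i: "i \<in> I" "s \<in> C i" and t: "t \<in> S" "digraph_iso (?\<Gamma> s) (?\<Gamma> t)" for i s t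
  proof (rule coarsest_partition_on_related_mem[OF assms(5) _ _ _ _ _ t])
    show "digraph_iso (?\<Gamma> s) (?\<Gamma> s)" if "s \<in> S" for s
      using that by (auto simp: iso_iff intro!: exI[of _ id])
    show "digraph_iso (?\<Gamma> t) (?\<Gamma> s)" if "s \<in> S" "digraph_iso (?\<Gamma> s) (?\<Gamma> t)" for s t
    proof (rule digraph_iso_swap[OF _ that(2)])
      show "wf_digraph (?\<Gamma> s)"
        using Xs_f[OF that(1)] by unfold_locales (auto simp: functional_digraph_def)
    qed
  qed (use i in \<open>auto intro: digraph_iso_trans\<close>)

  define Y where "Y i = (\<Union>s\<in>C i. Xs s)" for i
  have C_disj: "C i \<inter> C j = {}" if "i \<in> I" "j \<in> I" "i \<noteq> j" for i j
  proof -
    have "C i \<noteq> C j" using inj_onD[OF assms(4)] that by blast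
    then show ?thesis using part that by (simp add: partition_on_def disjoint_def)
  qed
  have UnY: "(\<Union>i\<in>I. Y i) = X"
    using part Un by (auto simp: Y_def partition_on_def)
  have Y_disj: "disjoint_family_on Y I"
    unfolding disjoint_family_on_def
  proof (intro ballI impI)
    fix i j assume i: "i \<in> I" and j: "j \<in> I" and ij: "i \<noteq> j"
    have "Xs s \<inter> Xs t = {}" if s: "s \<in> C i" and t: "t \<in> C j" for s t
    proof -
      have "s \<noteq> t" using C_disj[OF i j ij] s t by blast
      moreover have "s \<in> S" "t \<in> S" using CS i j s t by blast+
      ultimately show ?thesis using disj by (simp add: disjoint_family_on_def)
    qed
    then show "Y i \<inter> Y j = {}" unfolding Y_def by blast
  qed
  have Y_f: "f \<in> Y i \<rightarrow> Y i" if "i \<in> I" for i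
  proof
    fix x assume "x \<in> Y i"
    then obtain s where "s \<in> C i" "x \<in> Xs s" unfolding Y_def by blast
    then show "f x \<in> Y i" using Xs_f[of s] CS[OF that] unfolding Y_def by blast
  qed

  have prod: "Aut X f \<cong> product_group I (\<lambda>i. Aut (Y i) f)"
    unfolding UnY[symmetric]
  proof (rule Aut_stable_blocks_iso_product[OF Y_disj Y_f], goal_cases)
    case (2 \<sigma> i)
    then have \<sigma>: "\<sigma> \<in> carrier (Aut X f)" and i: "i \<in> I" by (auto simp: UnY)
    have "\<sigma> ` Xs s \<subseteq> Y i" if s: "s \<in> C i" for s
    proof -
      have sS: "s \<in> S" using s CS[OF i] by blast
      have "\<exists>t\<in>S. \<sigma> ` Xs s = Xs t"
        by (rule Aut_permutes_components[OF disj Xs_f Xs_ne Xs_conn _ sS]) (simp_all only: Un \<sigma>)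
      then obtain t where t: "t \<in> S" "\<sigma> ` Xs s = Xs t" by blast
      have "?conj s t \<sigma>"
      proof
        have bij: "bij_betw \<sigma> X X" and comm: "\<forall>x\<in>X. \<sigma> (f x) = f (\<sigma> x)"
          using \<sigma> by (simp_all add: in_carrier_Aut_iff)
        have "Xs s \<subseteq> X" using sS Un by blast
        then show "bij_betw \<sigma> (Xs s) (Xs t)" "\<forall>x\<in>Xs s. \<sigma> (f x) = f (\<sigma> x)"
          using bij_betw_subset[OF bij _ t(2)] comm by blast+
      qed
      then have "t \<in> C i" using C_closed[OF i s t(1)] iso_iff[OF sS t(1)] by blast
      then show ?thesis using t by (auto simp: Y_def)
    qed
    then show ?case by (auto simp: Y_def)
  qed

  have wr: "Aut (Y i) f \<cong> wreath_product (Aut (Xs (rep i)) (restrict f (Xs (rep i)))) (C i)"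
    if i: "i \<in> I" for i
  proof -
    let ?Z = "Xs (rep i)"
    have r: "rep i \<in> C i" "rep i \<in> S" using assms(6) i CS by auto
    have "\<exists>\<theta>. ?conj (rep i) c \<theta>" if "c \<in> C i" for c
      using C_iso[OF i r(1) that] iso_iff[OF r(2)] that CS[OF i] by blast
    then obtain \<theta> where \<theta>: "\<And>c. c \<in> C i \<Longrightarrow> ?conj (rep i) c (\<theta> c)"
      by metis
    have disj_i: "disjoint_family_on Xs (C i)"
      using disj CS[OF i] by (rule disjoint_family_on_mono[rotated])
    have sub: "c \<in> S" if "c \<in> C i" for c using that CS[OF i] by blast
    show ?thesis
      unfolding Y_def
    proof (rule Aut_isomorphic_blocks_iso_wreath[where \<theta> = \<theta>, OF disj_i])
      show "restrict f ?Z \<in> ?Z \<rightarrow> ?Z" using Xs_f[OF r(2)] by auto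
      show "?Z \<noteq> {}" using Xs_ne r by blast
      show "\<exists>d\<in>C i. \<sigma> ` Xs c = Xs d" if "\<sigma> \<in> carrier (Aut (\<Union>c\<in>C i. Xs c) f)" "c \<in> C i" for \<sigma> c
        by (rule Aut_permutes_components[OF disj_i _ _ _ that]) (use sub Xs_f Xs_ne Xs_conn in blast)+
    qed (use \<theta> in auto)
  qed

  have "product_group I (\<lambda>i. Aut (Y i) f) \<cong>
        product_group I (\<lambda>i. wreath_product (Aut (Xs (rep i)) (restrict f (Xs (rep i)))) (C i))"
  proof (rule iso_product_groupI[OF wr])
    fix i assume i: "i \<in> I"
    show "group (Aut (Y i) f)" by (rule group_Aut[OF Y_f[OF i]])
    have "rep i \<in> S" using assms(6) i CS by blast
    then have "restrict f (Xs (rep i)) \<in> Xs (rep i) \<rightarrow> Xs (rep i)" using Xs_f by auto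
    then show "group (wreath_product (Aut (Xs (rep i)) (restrict f (Xs (rep i)))) (C i))"
      by (intro group_wreath_product group_Aut)
  qed
  with prod show ?thesis by (rule iso_trans)
qed

end
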